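(* Let $X$ be a completely metrizable topological space of weight $\kappa \ge \aleph_0$, and let $\mathcal{R}$ be a countable family of $F_\sigma$ relations on $X$ (each $R\in\mathcal{R}$ is an $F_\sigma$ subset of $X^{n}$ for some finite arity $n=n(R)\ge 1$, possibly depending on $R$). Then exactly one of the following two statements holds. (S) There exists an ordinal $\gamma < \kappa^+$ such that every $\mathcal{R}$-independent set $A \subseteq X$ has Cantor-Bendixson rank $< \gamma$ (so that the $\gamma$-th Cantor-Bendixson derivative of every $\mathcal{R}$-independent set is empty). (P) There exists a perfect $\mathcal{R}$-independent set $P\subseteq X$.
   Context: Given an $n$-ary relation $R \subseteq X^n$, a set $S \subseteq X$ is $R$-independent if $(s_1,\dots,s_n)\notin R$ for all pairwise distinct $s_1,\dots,s_n\in S$. For a family $\mathcal{R}$ of relations on $X$ (possibly of different arities), $S$ is $\mathcal{R}$-independent if it is $R$-independent for every $R\in\mathcal{R}$. The weight of a topological space is the least cardinality of an open base. $\kappa^+$ is the successor cardinal of $\kappa$. A set is perfect if (with the subspace topology) it is nonempty, completely metrizable and has no isolated points. For a subset $A$ of a topological space, the Cantor-Bendixson derivatives are taken within $A$: $A^{(0)}=A$, $A^{(\gamma+1)}$ is the set of non-isolated points of the subspace $A^{(\gamma)}$, and $A^{(\lambda)}=\bigcap_{\gamma<\lambda}A^{(\gamma)}$ for limit $\lambda$. The Cantor-Bendixson rank of $A$ is the least ordinal $\gamma$ with $A^{(\gamma)}=\emptyset$, and it is $+\infty$ (above all ordinals) if no such $\gamma$ exists. *)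

theory Defs
  imports "HOL-Analysis.Analysis"
begin

unbundle cardinal_syntax

definition base_of :: "'a topology \<Rightarrow> 'a set set \<Rightarrow> bool"
  where "base_of X \<B> \<longleftrightarrow> openin X = arbitrary union_of (\<lambda>U. U \<in> \<B>)"

text \<open>Cardinals are the cardinal orders of the BNF library, taken up to \<open>=o\<close>; they may live on
  any type.\<close>

definition has_weight :: "'a topology \<Rightarrow> 'k rel \<Rightarrow> bool"
  where "has_weight X \<kappa> \<longleftrightarrow> Card_order \<kappa> \<and>
    (\<exists>\<B>. base_of X \<B> \<and> |\<B>| =o \<kappa>) \<and> (\<forall>\<B>. base_of X \<B> \<longrightarrow> \<kappa> \<le>o |\<B>| )"

text \<open>A relation of arity \<open>n\<close> on \<open>S\<close> is a set of tuples, a tuple being an extensional function on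
  \<open>{..<n}\<close>, i.e. a point of \<open>{..<n} \<rightarrow>\<^sub>E S\<close>; these are the points of the product topology.
  A family of relations is a set of pairs of an arity and a relation.\<close>

definition rel_independent :: "nat \<Rightarrow> (nat \<Rightarrow> 'a) set \<Rightarrow> 'a set \<Rightarrow> bool"
  where "rel_independent n R S \<longleftrightarrow> (\<forall>s \<in> {..<n} \<rightarrow>\<^sub>E S. inj_on s {..<n} \<longrightarrow> s \<notin> R)"

definition independent_set :: "'a topology \<Rightarrow> (nat \<times> (nat \<Rightarrow> 'a) set) set \<Rightarrow> 'a set \<Rightarrow> bool"
  where "independent_set X \<R> S \<longleftrightarrow>
    S \<subseteq> topspace X \<and> (\<forall>(n, R) \<in> \<R>. rel_independent n R S)"

definition non_isolated :: "'a topology \<Rightarrow> 'a set \<Rightarrow> 'a set"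
  where "non_isolated X A = {x \<in> A. \<not> openin (subtopology X A) {x}}"

definition perfect_subset :: "'a topology \<Rightarrow> 'a set \<Rightarrow> bool"
  where "perfect_subset X P \<longleftrightarrow> P \<subseteq> topspace X \<and> P \<noteq> {} \<and>
    completely_metrizable_space (subtopology X P) \<and> non_isolated X P = P"

text \<open>Ordinals are well-orders, taken up to \<open>=o\<close>. The ordinals below the order type of \<open>r\<close> are the
  order types of \<open>initial_segment r a\<close> for \<open>a \<in> Field r\<close>, and \<open>r\<close> is the successor of
  \<open>initial_segment r m\<close> exactly if \<open>m\<close> is the greatest element of \<open>r\<close>.\<close>

definition initial_segment :: "'o rel \<Rightarrow> 'o \<Rightarrow> 'o rel"
  where "initial_segment r a = Restr r (underS r a)"

definition is_greatest :: "'o rel \<Rightarrow> 'o \<Rightarrow> bool"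
  where "is_greatest r m \<longleftrightarrow> m \<in> Field r \<and> (\<forall>a \<in> Field r. (a, m) \<in> r)"

lemma initial_segment_ordLess:
  "Well_order r \<Longrightarrow> a \<in> Field r \<Longrightarrow> initial_segment r a <o r"
  unfolding initial_segment_def
  by (metis empty_iff underS_Restr_ordLess)

lemma is_greatest_the:
  assumes "Well_order r" "is_greatest r m"
  shows "(THE m. is_greatest r m) = m"
  using assms unfolding is_greatest_def order_on_defs
  by (intro the_equality) (auto dest: antisymD)

text \<open>The value for an \<open>r\<close> that is not a well-order is irrelevant.\<close>

function cb_deriv :: "'a topology \<Rightarrow> 'a set \<Rightarrow> 'o rel \<Rightarrow> 'a set"
  where "cb_deriv X A r =
    (if \<not> Well_order r then {}
     else if Field r = {} then A
     else if \<exists>m. is_greatest r m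
       then non_isolated X (cb_deriv X A (initial_segment r (THE m. is_greatest r m)))
     else (\<Inter>a \<in> Field r. cb_deriv X A (initial_segment r a)))"
  by pat_completeness auto
termination
proof (relation "inv_image ordLess (\<lambda>(X, A, r). r)", goal_cases)
  case 1
  show ?case by (rule wf_inv_image[OF wf_ordLess])
next
  case (2 X A r)
  then obtain m where "is_greatest r m" "Well_order r" by blast
  moreover from this have "initial_segment r m <o r"
    by (simp add: initial_segment_ordLess is_greatest_def)
  ultimately show ?case using is_greatest_the by fastforce
next
  case (3 X A r a)
  then show ?case by (simp add: initial_segment_ordLess)
qed

declare cb_deriv.simps [simp del]

text \<open>\<open>cb_deriv X A\<close> depends only on the order type:\<close>

lemma initial_segment_ordIso:
  assumes r: "Well_order r" and s: "Well_order s" and f: "iso r s f" and a: "a \<in> Field r"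
  shows "initial_segment r a =o initial_segment s (f a)"
proof -
  have "embed r s f" using f by (simp add: iso_def)
  then have inj: "inj_on f (Field r)" and im: "f ` underS r a = underS s (f a)"
    using r s a embed_inj_on[of r s f] embed_underS[of r s f a]
    by (auto simp: bij_betw_def)
  have fw: "\<forall>x\<in>Field r. \<forall>y\<in>Field r. (x, y) \<in> r \<longleftrightarrow> (f x, f y) \<in> s"
    using f iso_iff2 by metis
  have sub: "underS r a \<subseteq> Field r" by (auto simp: underS_def Field_def)
  have sub': "underS s (f a) \<subseteq> Field s" by (auto simp: underS_def Field_def)
  have F: "Field (initial_segment r a) = underS r a"
    unfolding initial_segment_def using r sub by (simp add: Refl_Field_Restr2 order_on_defs)
  have F': "Field (initial_segment s (f a)) = underS s (f a)"
    unfolding initial_segment_def using s sub' by (simp add: Refl_Field_Restr2 order_on_defs)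
  have "iso (initial_segment r a) (initial_segment s (f a)) f"
    unfolding iso_iff2 F F'
  proof (intro conjI ballI)
    show "bij_betw f (underS r a) (underS s (f a))"
      using inj sub im by (auto simp: bij_betw_def intro: inj_on_subset)
    fix x y assume "x \<in> underS r a" "y \<in> underS r a"
    then show "((x, y) \<in> initial_segment r a) = ((f x, f y) \<in> initial_segment s (f a))"
      using fw sub im unfolding initial_segment_def by blast
  qed
  moreover have "Well_order (initial_segment r a)" "Well_order (initial_segment s (f a))"
    unfolding initial_segment_def using r s Well_order_Restr by blast+
  ultimately show ?thesis unfolding ordIso_def by blast
qed

lemma cb_deriv_ordIso:
  fixes r :: "'o rel" and s :: "'p rel"
  assumes "r =o s"
  shows "cb_deriv X A r = cb_deriv X A s"
  using wf_ordLess assms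
proof (induction r arbitrary: s rule: wf_induct_rule)
  case (less r)
  then obtain f where r: "Well_order r" and s: "Well_order s" and f: "iso r s f"
    unfolding ordIso_def by blast
  then have bij: "bij_betw f (Field r) (Field s)"
    and fw: "\<forall>x\<in>Field r. \<forall>y\<in>Field r. (x, y) \<in> r \<longleftrightarrow> (f x, f y) \<in> s"
    using iso_iff2 by metis+
  then have Fs: "Field s = f ` Field r" by (simp add: bij_betw_def)
  have step: "cb_deriv X A (initial_segment r a) = cb_deriv X A (initial_segment s (f a))"
    if "a \<in> Field r" for a
    using less.IH initial_segment_ordLess[OF r that] initial_segment_ordIso[OF r s f that] by blast
  have gr: "is_greatest r m \<Longrightarrow> is_greatest s (f m)" for m
    using fw by (auto simp: is_greatest_def Fs)
  have gs: "is_greatest s m' \<Longrightarrow> \<exists>m. is_greatest r m" for m'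
    using fw by (auto simp: is_greatest_def Fs)
  show ?case
  proof (cases "\<exists>m. is_greatest r m")
    case True
    then obtain m where m: "is_greatest r m" by blast
    then have "m \<in> Field r" by (simp add: is_greatest_def)
    then show ?thesis
      using r s m gr[OF m] step[of m] is_greatest_the[OF r m] is_greatest_the[OF s gr[OF m]]
      by (subst (1 2) cb_deriv.simps) (auto simp: Fs)
  next
    case False
    then have "\<nexists>m. is_greatest s m" using gs by blast
    with False show ?thesis
      using r s step by (subst (1 2) cb_deriv.simps) (auto simp: Fs)
  qed
qed

definition has_cb_rank :: "'a topology \<Rightarrow> 'a set \<Rightarrow> 'o rel \<Rightarrow> bool"
  where "has_cb_rank X A \<rho> \<longleftrightarrow> Well_order \<rho> \<and> cb_deriv X A \<rho> = {} \<and>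
    (\<forall>a \<in> Field \<rho>. cb_deriv X A (initial_segment \<rho> a) \<noteq> {})"

text \<open>Rank \<open>+\<infinity>\<close> means that no well-order satisfies \<open>has_cb_rank\<close>, so it is not below any \<open>\<gamma>\<close>.
  Taking \<open>\<rho>\<close> on the type of \<open>\<gamma>\<close> is no restriction, since every ordinal below \<open>\<gamma>\<close> is the type of an
  initial segment of \<open>\<gamma>\<close>. Likewise an ordinal below \<open>\<kappa>\<^sup>+\<close> is the type of an initial segment of
  \<open>cardSuc \<kappa>\<close>, so for \<open>\<kappa> :: 'k rel\<close> all such ordinals occur on the type \<open>'k set\<close>.\<close>

definition cb_rank_less :: "'a topology \<Rightarrow> 'a set \<Rightarrow> 'o rel \<Rightarrow> bool"
  where "cb_rank_less X A \<gamma> \<longleftrightarrow> (\<exists>\<rho> :: 'o rel. has_cb_rank X A \<rho> \<and> \<rho> <o \<gamma>)"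

end

theory Submission
  imports Defs
begin

text \<open>A perfect set equals all its derivatives (\<open>cb_deriv_dense_in_itself\<close>), so a perfect independent
  set rules out any bound on the ranks. The substance is the converse: independent sets whose derivatives
  survive up to every ordinal below \<open>\<kappa>\<^sup>+\<close> force a perfect independent set.

  First, every \<open>F\<^sub>\<sigma>\<close> relation is a countable union of closed ones, and independence from a union is
  independence from each part. So there is a sequence of closed relations to avoid, and being
  avoided by a tuple of distinct points is an open condition. A perfect set is then built by a
  Cantor scheme: for every finite binary word \<open>s\<close> a nonempty open set \<open>u s\<close>, where the sets of one
  level are disjoint, the diameters shrink, the closure of each set lies in its parent, and no
  tuple chosen from different sets of level \<open>n + 1\<close> satisfies one of the relations with index at
  most \<open>n\<close>. Distinct branches run through different sets from some level on, so the set of branch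
  points is independent (\<open>scheme_independent\<close>), and it is perfect (\<open>Cantor_scheme_perfect\<close>).

  What has to be explained is why one can keep splitting. Call the sets \<open>U s\<close> of level \<open>n\<close> good if
  for every \<open>\<gamma> < \<kappa>\<^sup>+\<close> there is a single independent set \<open>A\<close> whose \<open>\<gamma>\<close>-th derivative meets all of them.
  Points of the derivative of order \<open>\<gamma> + 1\<close> are limits of points of the \<open>\<gamma>\<close>-th derivative, so each
  \<open>U s\<close> contains two distinct points of the latter; since \<open>A\<close> is independent, all these points have
  small basic neighbourhoods that satisfy every requirement on the next level
  (\<open>split_at_non_isolated_points\<close>). The choice of
  neighbourhoods depends on \<open>\<gamma>\<close>, but there are only \<open>\<kappa>\<close> finite families of basic sets. If each of
  them failed to be good at some ordinal below \<open>\<kappa>\<^sup>+\<close>, these ordinals would have a common bound below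
  \<open>\<kappa>\<^sup>+\<close> (\<open>bounded_in_cardSuc\<close>), and splitting beyond that bound gives a contradiction. So some
  good family splits the given one, and dependent choice yields the scheme.\<close>

section \<open>Derivatives along the initial segments of a well-order\<close>

lemma Field_initial_segment:
  assumes "Well_order r"
  shows "Field (initial_segment r a) = underS r a"
proof -
  have "underS r a \<subseteq> Field r" by (auto simp: underS_def Field_def)
  then show ?thesis
    unfolding initial_segment_def using assms by (simp add: Refl_Field_Restr2 order_on_defs)
qed

lemma Well_order_initial_segment: "Well_order r \<Longrightarrow> Well_order (initial_segment r a)"
  unfolding initial_segment_def by (rule Well_order_Restr)

lemma initial_segment_initial_segment:
  assumes "Well_order r" "b \<in> underS r a"
  shows "initial_segment (initial_segment r a) b = initial_segment r b"
proof -
  have tr: "trans r" and as: "antisym r" using assms(1) by (auto simp: order_on_defs)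
  have sub: "underS r b \<subseteq> underS r a"
    using assms(2) tr as by (auto simp: underS_def dest: transD antisymD)
  then have "underS (Restr r (underS r a)) b = underS r b"
    using assms(2) by (auto simp: underS_def)
  with sub show ?thesis unfolding initial_segment_def by auto
qed

lemma Well_order_le_or_underS:
  assumes "Well_order r" "a \<in> Field r" "b \<in> Field r"
  shows "(a, b) \<in> r \<or> b \<in> underS r a"
  using assms unfolding order_on_defs underS_def total_on_def
  by (cases "a = b") (auto simp: refl_on_def)

lemma non_isolatedD: "x \<in> non_isolated X A \<Longrightarrow> x \<in> A"
  by (auto simp: non_isolated_def)

text \<open>This one formula covers the zero, successor and limit clauses of the recursion, so that later
  arguments need no case distinction. In the successor case the top derivative is contained in all
  earlier ones; in the limit case every element of \<open>r\<close> lies strictly below another one.\<close>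

lemma cb_deriv_eq:
  assumes "Well_order r"
  shows "cb_deriv X A r =
    {x \<in> A. \<forall>a \<in> Field r. x \<in> non_isolated X (cb_deriv X A (initial_segment r a))}"
  using wf_ordLess assms
proof (induction r rule: wf_induct_rule)
  case (less r)
  note r = less.prems
  define D where "D a = cb_deriv X A (initial_segment r a)" for a
  have D: "D a = {x \<in> A. \<forall>b \<in> underS r a. x \<in> non_isolated X (D b)}" if "a \<in> Field r" for a
    unfolding D_def
    using less.IH[OF initial_segment_ordLess[OF r that] Well_order_initial_segment[OF r]]
    by (simp add: Field_initial_segment[OF r] initial_segment_initial_segment[OF r] cong: ball_cong)
  have tot: "a \<in> Field r \<Longrightarrow> b \<in> Field r \<Longrightarrow> (a, b) \<notin> r \<Longrightarrow> b \<in> underS r a" for a b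
    using Well_order_le_or_underS[OF r] by blast
  consider (zero) "Field r = {}" | (succ) m where "is_greatest r m"
    | (limit) "Field r \<noteq> {}" "\<nexists>m. is_greatest r m" by blast
  then have "cb_deriv X A r = {x \<in> A. \<forall>a \<in> Field r. x \<in> non_isolated X (D a)}"
  proof cases
    case zero
    then show ?thesis using r by (subst cb_deriv.simps) simp
  next
    case (succ m)
    have m: "m \<in> Field r" and max: "\<And>a. a \<in> Field r \<Longrightarrow> (a, m) \<in> r"
      using succ by (auto simp: is_greatest_def)
    have "cb_deriv X A r = non_isolated X (D m)"
    proof -
      have "Field r \<noteq> {}" "\<exists>m. is_greatest r m" using m succ by blast+
      then show ?thesis
        unfolding D_def
        by (subst cb_deriv.simps)
          (simp only: r is_greatest_the[OF r succ] if_True if_False not_True_eq_False)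
    qed
    also have "\<dots> = {x \<in> A. \<forall>a \<in> Field r. x \<in> non_isolated X (D a)}"
    proof (intro equalityI subsetI CollectI conjI ballI)
      fix x assume x: "x \<in> non_isolated X (D m)"
      then have xm: "x \<in> D m" by (rule non_isolatedD)
      then show "x \<in> A" using D[OF m] by blast
      fix a assume "a \<in> Field r"
      then show "x \<in> non_isolated X (D a)"
        using x xm D[OF m] max by (cases "a = m") (auto simp: underS_def)
    qed (use m in blast)
    finally show ?thesis .
  next
    case limit
    have "cb_deriv X A r = (\<Inter>a \<in> Field r. D a)"
      using r limit unfolding D_def by (subst cb_deriv.simps) auto
    also have "\<dots> = {x \<in> A. \<forall>a \<in> Field r. x \<in> non_isolated X (D a)}"
    proof (intro equalityI subsetI CollectI conjI ballI)
      fix x assume x: "x \<in> (\<Inter>a \<in> Field r. D a)"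
      then show "x \<in> A" using limit(1) D by blast
      fix a assume a: "a \<in> Field r"
      then obtain c where c: "c \<in> Field r" "(c, a) \<notin> r"
        using limit(2) unfolding is_greatest_def by blast
      then have "a \<in> underS r c" using tot a by blast
      then show "x \<in> non_isolated X (D a)" using x D[OF c(1)] c(1) by blast
    next
      fix x assume "x \<in> {x \<in> A. \<forall>a \<in> Field r. x \<in> non_isolated X (D a)}"
      moreover have "underS r a \<subseteq> Field r" for a by (auto simp: underS_def Field_def)
      ultimately show "x \<in> (\<Inter>a \<in> Field r. D a)" using D by blast
    qed
    finally show ?thesis .
  qed
  then show ?case unfolding D_def .
qed

lemma cb_deriv_subset: "Well_order r \<Longrightarrow> cb_deriv X A r \<subseteq> A"
  by (subst cb_deriv_eq) auto

lemma cb_deriv_initial_segment_subset: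
  assumes "Well_order r" "a \<in> underS r b"
  shows "cb_deriv X A (initial_segment r b) \<subseteq> non_isolated X (cb_deriv X A (initial_segment r a))"
  using assms
  by (subst cb_deriv_eq[OF Well_order_initial_segment[OF assms(1)]])
    (auto simp: Field_initial_segment initial_segment_initial_segment)

lemma cb_deriv_dense_in_itself:
  assumes "Well_order r" "non_isolated X P = P"
  shows "cb_deriv X P r = P"
  using wf_ordLess assms(1)
proof (induction r rule: wf_induct_rule)
  case (less r)
  then have "cb_deriv X P (initial_segment r a) = P" if "a \<in> Field r" for a
    using that by (simp add: initial_segment_ordLess Well_order_initial_segment)
  then show ?case using assms(2) by (subst cb_deriv_eq[OF less.prems]) auto
qed

text \<open>The rank is the least \<open>c\<close> at which the derivative is empty; it is at most \<open>a\<close>, hence strictly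
  below \<open>b\<close>.\<close>

lemma cb_rank_less_initial_segment:
  fixes r :: "'o rel"
  assumes r: "Well_order r" and ab: "a \<in> underS r b"
    and empty: "cb_deriv X A (initial_segment r a) = {}"
  shows "cb_rank_less X A (initial_segment r b)"
proof -
  let ?E = "{c \<in> Field r. cb_deriv X A (initial_segment r c) = {}}"
  have a: "a \<in> ?E" using ab empty by (auto simp: underS_def Field_def)
  have "wf (r - Id)" using r by (simp add: order_on_defs)
  then obtain c where c: "c \<in> ?E" and min: "\<And>d. (d, c) \<in> r - Id \<Longrightarrow> d \<notin> ?E"
    using a unfolding wf_eq_minimal by meson
  have "(c, a) \<in> r"
    using Well_order_le_or_underS[OF r, of c a] min[of a] a c by (auto simp: underS_def)
  then have cb: "c \<in> underS r b"
    using ab r unfolding order_on_defs underS_def by (auto dest: transD antisymD)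
  have "has_cb_rank X A (initial_segment r c)"
    unfolding has_cb_rank_def
  proof (intro conjI ballI)
    fix d assume "d \<in> Field (initial_segment r c)"
    then have d: "d \<in> underS r c" by (simp add: Field_initial_segment[OF r])
    then have "d \<notin> ?E" "d \<in> Field r" using min by (auto simp: underS_def Field_def)
    then show "cb_deriv X A (initial_segment (initial_segment r c) d) \<noteq> {}"
      using d by (simp add: initial_segment_initial_segment[OF r])
  qed (use c r Well_order_initial_segment in auto)
  moreover have "initial_segment r c <o initial_segment r b"
    using initial_segment_ordLess[OF Well_order_initial_segment[OF r, of b], of c] cb
    by (simp add: Field_initial_segment[OF r] initial_segment_initial_segment[OF r])
  ultimately show ?thesis unfolding cb_rank_less_def by blast
qed

section \<open>Bounds in the successor cardinal\<close>

text \<open>This is the regularity of \<open>\<kappa>\<^sup>+\<close>: the initial segments below the \<open>f t\<close> have size at most \<open>\<kappa>\<close>, so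
  the union of at most \<open>\<kappa>\<close> of them cannot exhaust \<open>\<kappa>\<^sup>+\<close>.\<close>

lemma bounded_in_cardSuc:
  fixes \<kappa> :: "'k rel"
  assumes \<kappa>: "Card_order \<kappa>" "\<not> finite (Field \<kappa>)" and T: "|T| \<le>o \<kappa>"
    and f: "\<And>t. t \<in> T \<Longrightarrow> f t \<in> Field (cardSuc \<kappa>)"
  shows "\<exists>c \<in> Field (cardSuc \<kappa>). \<forall>t \<in> T. f t \<in> underS (cardSuc \<kappa>) c"
proof (rule ccontr)
  let ?r = "cardSuc \<kappa>"
  assume "\<not> ?thesis"
  then have none: "\<And>c. c \<in> Field ?r \<Longrightarrow> \<exists>t \<in> T. f t \<notin> underS ?r c" by blast
  have co: "Card_order ?r" using \<kappa> by (simp add: cardSuc_Card_order)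
  then have wo: "Well_order ?r" by (simp add: card_order_on_def)
  have inf: "\<not> finite (Field ?r)" using \<kappa> cardSuc_finite by blast
  have small: "|underS ?r a| \<le>o \<kappa>" if "a \<in> Field ?r" for a
    using card_of_underS[OF co that] cardSuc_ordLeq_ordLess[OF \<kappa>(1) card_of_Card_order]
      by blast
  have cover: "Field ?r \<subseteq> (\<Union>t \<in> T. insert (f t) (underS ?r (f t)))"
  proof
    fix c assume c: "c \<in> Field ?r"
    then obtain t where t: "t \<in> T" "f t \<notin> underS ?r c" using none by blast
    then have "c = f t \<or> (c, f t) \<in> ?r"
      using Well_order_le_or_underS[OF wo c f[OF t(1)]] by (auto simp: underS_def)
    then show "c \<in> (\<Union>t \<in> T. insert (f t) (underS ?r (f t)))"
      using t by (auto simp: underS_def)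
  qed
  have ins: "|insert (f t) (underS ?r (f t))| \<le>o \<kappa>" if "t \<in> T" for t
  proof -
    have "|{f t}| \<le>o |Field \<kappa>|" using \<kappa>(2) by (intro card_of_singl_ordLeq) auto
    then have "|{f t}| \<le>o \<kappa>"
      by (rule ordLeq_ordIso_trans[OF _ card_of_Field_ordIso[OF \<kappa>(1)]])
    then have "|{f t} \<union> underS ?r (f t)| \<le>o \<kappa>"
      by (rule card_of_Un_ordLeq_infinite_Field[OF \<kappa>(2) _ small[OF f[OF that]] \<kappa>(1)])
    then show ?thesis by simp
  qed
  have "|\<Union>t \<in> T. insert (f t) (underS ?r (f t))| \<le>o \<kappa>"
    by (intro card_of_UNION_ordLeq_infinite_Field[OF \<kappa>(2,1) T] ballI ins)
  then have "|Field ?r| \<le>o \<kappa>" by (rule ordLeq_transitive[OF card_of_mono1[OF cover]])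
  then have "?r \<le>o \<kappa>"
    by (rule ordIso_ordLeq_trans[OF ordIso_symmetric[OF card_of_Field_ordIso[OF co]]])
  then show False using cardSuc_greater[OF \<kappa>(1)] not_ordLess_ordLeq by blast
qed

lemma card_of_PiE_ordLeq_infinite:
  assumes \<kappa>: "Card_order \<kappa>" "\<not> finite (Field \<kappa>)" and B: "|B| \<le>o \<kappa>" and "finite I"
  shows "|I \<rightarrow>\<^sub>E B| \<le>o \<kappa>"
  using \<open>finite I\<close>
proof induction
  case empty
  have "|{\<lambda>x. undefined}| \<le>o |Field \<kappa>|" using \<kappa>(2) by (intro card_of_singl_ordLeq) auto
  then have "|{\<lambda>x. undefined}| \<le>o \<kappa>"
    by (rule ordLeq_ordIso_trans[OF _ card_of_Field_ordIso[OF \<kappa>(1)]])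
  then show ?case by simp
next
  case (insert i I)
  have "|B \<times> (I \<rightarrow>\<^sub>E B)| \<le>o \<kappa>"
    using card_of_Times_ordLeq_infinite_Field[OF \<kappa>(2) B insert.IH \<kappa>(1)] .
  then show ?case
    unfolding PiE_insert_eq by (rule ordLeq_transitive[OF card_of_image])
qed

section \<open>Cantor schemes in complete metric spaces\<close>

lemma snoc_butlast_last: "length t = Suc n \<Longrightarrow> butlast t @ [last t] = t"
  by (cases t rule: rev_cases) auto

text \<open>Completeness gives every branch \<open>f\<close> of the binary tree a limit point \<open>g f\<close>. By disjointness a point
  of \<open>u\<close>-sets on all levels determines its branch, so the set of limit points equals an intersection
  of finite unions of closures; hence it is closed, and completely metrizable. No point is isolated,
  because changing a late value of \<open>f\<close> moves \<open>g f\<close> by an arbitrarily small but nonzero distance.\<close>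

lemma (in Metric_space) Cantor_scheme_perfect:
  fixes u :: "bool list \<Rightarrow> 'a set"
  assumes mcomplete
    and ne: "\<And>s. u s \<noteq> {}" and sub: "\<And>s. u s \<subseteq> M"
    and nest: "\<And>s b. mtopology closure_of u (s @ [b]) \<subseteq> u s"
    and small: "\<And>s b. \<exists>c. u (s @ [b]) \<subseteq> mcball c (1 / 2 ^ length s)"
    and disj: "\<And>s t. length s = length t \<Longrightarrow> s \<noteq> t \<Longrightarrow> u s \<inter> u t = {}"
  shows "\<exists>g. (\<forall>f n. g f \<in> u (map f [0..<n])) \<and> perfect_subset mtopology (range g)"
proof -
  define node where "node f n = map f [0..<n]" for f :: "nat \<Rightarrow> bool" and n
  have node_Suc: "node f (Suc n) = node f n @ [f n]" for f n by (simp add: node_def)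
  have len[simp]: "length (node f n) = n" for f n by (simp add: node_def)
  define C where "C f n = mtopology closure_of u (node f n)" for f n
  have uC: "u (node f n) \<subseteq> C f n" for f n
    unfolding C_def using sub by (intro closure_of_subset) simp
  have Cu: "C f (Suc n) \<subseteq> u (node f n)" for f n
    unfolding C_def node_Suc by (rule nest)
  have Csmall: "\<exists>c. C f (Suc n) \<subseteq> mcball c (1 / 2 ^ n)" for f n
    using small[of "node f n" "f n"] closure_of_minimal[OF _ closedin_mcball]
    unfolding C_def node_Suc len by blast
  have "\<exists>l. l \<in> M \<and> \<Inter> (range (C f)) = {l}" for f
  proof -
    have "\<forall>n. closedin mtopology (C f n)" by (simp add: C_def)
    moreover have "\<forall>n. C f n \<noteq> {}" using uC ne by (metis subset_empty)
    moreover have "decseq (C f)" using Cu uC by (intro decseq_SucI) blast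
    moreover have "\<forall>e>0. \<exists>n a. C f n \<subseteq> mcball a e"
    proof (intro allI impI)
      fix e :: real assume "e > 0"
      then obtain n where n: "1 / 2 ^ n < e"
        using real_arch_pow_inv[of e "1 / 2"] by (auto simp: power_one_over)
      obtain c where "C f (Suc n) \<subseteq> mcball c (1 / 2 ^ n)" using Csmall by blast
      then have "C f (Suc n) \<subseteq> mcball c e" using n by force
      then show "\<exists>n a. C f n \<subseteq> mcball a e" by blast
    qed
    ultimately show ?thesis using \<open>mcomplete\<close> unfolding mcomplete_nest_sing by blast
  qed
  then obtain g where g: "\<And>f. \<Inter> (range (C f)) = {g f}" by metis
  have gu: "g f \<in> u (node f n)" for f n using g[of f] Cu[of f n] by blast
  have g_unique: "x = g f" if "\<And>n. x \<in> u (node f n)" for x f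
    using that g[of f] uC[of f] by blast
  have inM: "range g \<subseteq> M" using gu sub by blast
  have range_eq: "range g = (\<Inter>n. \<Union>s \<in> {s. length s = n}. mtopology closure_of u s)"
  proof (intro equalityI subsetI)
    fix x assume "x \<in> range g"
    then obtain f where "x = g f" by blast
    then have "x \<in> mtopology closure_of u (node f n)" for n
      using gu[of f n] uC[of f n] unfolding C_def by blast
    then show "x \<in> (\<Inter>n. \<Union>s \<in> {s. length s = n}. mtopology closure_of u s)"
      using len by blast
  next
    fix x assume x: "x \<in> (\<Inter>n. \<Union>s \<in> {s. length s = n}. mtopology closure_of u s)"
    \<comment> \<open>Closures of one level are contained in the open sets of the previous one.\<close>
    have "\<exists>s. length s = n \<and> x \<in> u s" for n
    proof -
      obtain s where s: "length s = Suc n" "x \<in> mtopology closure_of u s" using x by blast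
      then have "x \<in> u (butlast s)"
        using nest[of "butlast s" "last s"] by (auto simp: snoc_butlast_last)
      then show ?thesis using s(1) by (intro exI[of _ "butlast s"]) simp
    qed
    then obtain s where s: "\<And>n. length (s n) = n" "\<And>n. x \<in> u (s n)" by metis
    define f where "f n = last (s (Suc n))" for n
    have "s n = node f n" for n
    proof (induction n)
      case 0
      then show ?case using s(1)[of 0] by (simp add: node_def)
    next
      case (Suc n)
      have eq: "s (Suc n) = butlast (s (Suc n)) @ [f n]"
        unfolding f_def using snoc_butlast_last[OF s(1)[of "Suc n"]] by simp
      then have "u (s (Suc n)) \<subseteq> u (butlast (s (Suc n)))"
        using nest[of "butlast (s (Suc n))" "f n"] sub closure_of_subset[of "u (s (Suc n))" mtopology]
        by auto
      then have "butlast (s (Suc n)) = s n"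
        using disj[of "butlast (s (Suc n))" "s n"] s by fastforce
      then show ?case using eq Suc by (simp add: node_Suc)
    qed
    then show "x \<in> range g" using g_unique s(2) by (metis rangeI)
  qed
  have "closedin mtopology (range g)"
    unfolding range_eq
  proof (intro closedin_Inter)
    fix K assume "K \<in> range (\<lambda>n. \<Union>s \<in> {s::bool list. length s = n}. mtopology closure_of u s)"
    then obtain n where K: "K = (\<Union>s \<in> {s::bool list. length s = n}. mtopology closure_of u s)"
      by blast
    have "finite {s::bool list. length s = n}"
      using finite_lists_length_eq[of "UNIV :: bool set" n] by simp
    then show "closedin mtopology K" unfolding K by (intro closedin_Union) auto
  qed auto
  then have complete: "completely_metrizable_space (subtopology mtopology (range g))"
    using completely_metrizable_space_closedin completely_metrizable_space_mtopology \<open>mcomplete\<close>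
    by blast
  have "\<not> openin (subtopology mtopology (range g)) {g f}" for f
  proof
    assume "openin (subtopology mtopology (range g)) {g f}"
    then obtain W where W: "openin mtopology W" "{g f} = W \<inter> range g"
      unfolding openin_subtopology by blast
    then obtain r where r: "r > 0" "mball (g f) r \<subseteq> W"
      unfolding openin_mtopology by blast
    obtain n where n: "1 / 2 ^ n < r / 2"
      using real_arch_pow_inv[of "r / 2" "1 / 2"] r(1) by (auto simp: power_one_over)
    \<comment> \<open>A branch that leaves \<open>f\<close> just after the level at which \<open>u\<close> is small compared to \<open>r\<close>.\<close>
    define f' where "f' = f(Suc n := \<not> f (Suc n))"
    have same: "node f' (Suc n) = node f (Suc n)" unfolding node_def f'_def by simp
    obtain c where c: "u (node f (Suc n)) \<subseteq> mcball c (1 / 2 ^ n)"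
      using Csmall[of f n] uC by blast
    have "g f \<in> mcball c (1 / 2 ^ n)" "g f' \<in> mcball c (1 / 2 ^ n)"
      using c gu[of f "Suc n"] gu[of f' "Suc n"] same by auto
    then have "g f' \<in> mball (g f) r"
      using n triangle[of "g f" c "g f'"] by (auto simp: commute)
    then have "g f' = g f" using r W(2) by blast
    moreover have "node f' (Suc (Suc n)) \<noteq> node f (Suc (Suc n))"
      by (simp add: node_Suc f'_def)
    ultimately show False
      using disj[of "node f' (Suc (Suc n))" "node f (Suc (Suc n))"] gu[of f "Suc (Suc n)"]
        gu[of f' "Suc (Suc n)"] by auto
  qed
  then have "non_isolated mtopology (range g) = range g"
    unfolding non_isolated_def by blast
  then have "perfect_subset mtopology (range g)"
    unfolding perfect_subset_def using inM complete by simp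
  then show ?thesis using gu unfolding node_def by blast
qed

section \<open>Splitting a finite family of open sets\<close>

text \<open>Each requirement on the next level of a scheme holds for all closed balls of small enough radius
  around the chosen points. Expressed with the filter \<open>at_right 0\<close>, finitely many requirements can be
  met at once without choosing radii by hand.\<close>

lemma (in Metric_space) eventually_mcball_subset:
  assumes "openin mtopology U" "p \<in> U"
  shows "\<forall>\<^sub>F \<epsilon> in at_right 0. mcball p \<epsilon> \<subseteq> U"
proof -
  obtain r where r: "r > 0" "mcball p r \<subseteq> U"
    using assms unfolding openin_mtopology_mcball by blast
  then have "mcball p \<epsilon> \<subseteq> U" if "\<epsilon> < r" for \<epsilon> using that by force
  then show ?thesis using r(1) unfolding eventually_at_right_field by blast
qed

lemma (in Metric_space) eventually_disjoint_mcball: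
  assumes "p \<in> M" "q \<in> M" "p \<noteq> q"
  shows "\<forall>\<^sub>F \<epsilon> in at_right 0. mcball p \<epsilon> \<inter> mcball q \<epsilon> = {}"
proof -
  have pos: "d p q / 2 > 0" using assms by simp
  have "mcball p \<epsilon> \<inter> mcball q \<epsilon> = {}" if "\<epsilon> < d p q / 2" for \<epsilon>
  proof (rule ccontr)
    assume "\<not> ?thesis"
    then obtain z where "z \<in> M" "d p z \<le> \<epsilon>" "d q z \<le> \<epsilon>" by auto
    then show False using triangle[of p z q] assms that by (simp add: commute)
  qed
  then show ?thesis using pos unfolding eventually_at_right_field by blast
qed

lemma (in Metric_space) eventually_box_avoids_closed:
  assumes R: "closedin (product_topology (\<lambda>_. mtopology) {..<n}) R"
    and p: "p \<in> {..<n::nat} \<rightarrow>\<^sub>E M" "p \<notin> R"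
  shows "\<forall>\<^sub>F \<epsilon> in at_right 0. (\<Pi>\<^sub>E i\<in>{..<n}. mcball (p i) \<epsilon>) \<inter> R = {}"
proof -
  have "openin (product_topology (\<lambda>_. mtopology) {..<n}) (({..<n} \<rightarrow>\<^sub>E M) - R)"
    using R by (simp add: closedin_def)
  moreover have "p \<in> ({..<n} \<rightarrow>\<^sub>E M) - R" using p by blast
  ultimately have "\<exists>U. finite {i \<in> {..<n}. U i \<noteq> topspace mtopology} \<and>
      (\<forall>i \<in> {..<n}. openin mtopology (U i)) \<and> p \<in> Pi\<^sub>E {..<n} U \<and>
      Pi\<^sub>E {..<n} U \<subseteq> ({..<n} \<rightarrow>\<^sub>E M) - R"
    unfolding openin_product_topology_alt by (rule bspec)
  then obtain U where U: "\<forall>i \<in> {..<n}. openin mtopology (U i)" "p \<in> Pi\<^sub>E {..<n} U"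
      "Pi\<^sub>E {..<n} U \<subseteq> ({..<n} \<rightarrow>\<^sub>E M) - R"
    by metis
  have "\<forall>\<^sub>F \<epsilon> in at_right 0. \<forall>i \<in> {..<n}. mcball (p i) \<epsilon> \<subseteq> U i"
  proof (rule eventually_ball_finite)
    show "\<forall>i \<in> {..<n}. \<forall>\<^sub>F \<epsilon> in at_right 0. mcball (p i) \<epsilon> \<subseteq> U i"
      using U(1,2) by (metis PiE_mem eventually_mcball_subset)
  qed simp
  then show ?thesis
  proof eventually_elim
    case (elim \<epsilon>)
    then have "(\<Pi>\<^sub>E i\<in>{..<n}. mcball (p i) \<epsilon>) \<subseteq> Pi\<^sub>E {..<n} U" by (intro PiE_mono) auto
    also note U(3)
    finally show ?case by (metis Diff_disjoint Int_commute inf.orderE inf_assoc inf_bot_right)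
  qed
qed

text \<open>The requirements that lead from level \<open>n\<close> of a Cantor scheme to level \<open>n + 1\<close>. Level \<open>n + 1\<close> takes
  care of the relations \<open>R 0, \<dots>, R n\<close> only, so that there are finitely many conditions on each level,
  but every relation is taken care of on all but finitely many levels.\<close>

definition (in Metric_space) splits ::
    "(nat \<Rightarrow> nat) \<Rightarrow> (nat \<Rightarrow> (nat \<Rightarrow> 'a) set) \<Rightarrow> nat \<Rightarrow>
      (bool list \<Rightarrow> 'a set) \<Rightarrow> (bool list \<Rightarrow> 'a set) \<Rightarrow> bool"
  where "splits N R n U V \<longleftrightarrow>
    (\<forall>s b. length s = n \<longrightarrow>
      mtopology closure_of V (s @ [b]) \<subseteq> U s \<and> (\<exists>c. V (s @ [b]) \<subseteq> mcball c (1 / 2 ^ n))) \<and>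
    (\<forall>s t. length s = Suc n \<longrightarrow> length t = Suc n \<longrightarrow> s \<noteq> t \<longrightarrow> V s \<inter> V t = {}) \<and>
    (\<forall>k\<le>n. \<forall>\<sigma> \<in> {..<N k} \<rightarrow>\<^sub>E {s. length s = Suc n}. inj_on \<sigma> {..<N k} \<longrightarrow>
      (\<Pi>\<^sub>E i\<in>{..<N k}. V (\<sigma> i)) \<inter> R k = {})"

lemma base_of_openin: "base_of X B \<Longrightarrow> U \<in> B \<Longrightarrow> openin X U"
  unfolding base_of_def openin_topology_base_unique by simp

lemma base_ofE:
  assumes "base_of X B" "openin X U" "x \<in> U"
  obtains V where "V \<in> B" "x \<in> V" "V \<subseteq> U"
proof -
  have "\<forall>U x. openin X U \<and> x \<in> U \<longrightarrow> (\<exists>V. V \<in> B \<and> x \<in> V \<and> V \<subseteq> U)"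
    using assms(1) unfolding base_of_def openin_topology_base_unique by (rule conjunct2)
  with assms(2,3) that show ?thesis by metis
qed

text \<open>In each \<open>U s\<close> the non-isolated point of \<open>E\<close> comes with a second point of \<open>E\<close>. The resulting
  \<open>2 * 2 ^ n\<close> points are distinct members of the independent set \<open>A\<close>, so no tuple of different ones
  satisfies a relation, and this persists for tuples from small neighbourhoods. The new sets are
  taken from the base \<open>B\<close> because there are few families of basic sets.\<close>

lemma (in Metric_space) split_at_non_isolated_points:
  fixes U :: "bool list \<Rightarrow> 'a set"
  assumes B: "base_of mtopology B"
    and U: "\<And>s. length s = n \<Longrightarrow> openin mtopology (U s)"
    and disj: "\<And>s t. length s = n \<Longrightarrow> length t = n \<Longrightarrow> s \<noteq> t \<Longrightarrow> U s \<inter> U t = {}"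
    and R: "\<And>k. closedin (product_topology (\<lambda>_. mtopology) {..<N k}) (R k)"
    and A: "A \<subseteq> M" "\<And>k. rel_independent (N k) (R k) A"
    and E: "E \<subseteq> A" "\<And>s. length s = n \<Longrightarrow> non_isolated mtopology E \<inter> U s \<noteq> {}"
  shows "\<exists>V \<in> {s. length s = Suc n} \<rightarrow>\<^sub>E B. splits N R n U V \<and>
    (\<forall>s. length s = Suc n \<longrightarrow> E \<inter> V s \<noteq> {})"
proof -
  let ?I = "{s::bool list. length s = Suc n}"
  have finI: "finite ?I" using finite_lists_length_eq[of "UNIV :: bool set" "Suc n"] by simp
  have "\<exists>x y. x \<in> E \<inter> U s \<and> y \<in> E \<inter> U s \<and> x \<noteq> y" if s: "length s = n" for s
  proof -
    obtain x where x: "x \<in> non_isolated mtopology E" "x \<in> U s" using E(2)[OF s] by blast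
    have "openin (subtopology mtopology E) (U s \<inter> E)"
      using U[OF s] unfolding openin_subtopology by blast
    then have "U s \<inter> E \<noteq> {x}" using x(1) unfolding non_isolated_def by auto
    then show ?thesis using x non_isolatedD[OF x(1)] by blast
  qed
  then obtain x y where xy: "\<And>s. length s = n \<Longrightarrow> x s \<in> E \<inter> U s \<and> y s \<in> E \<inter> U s \<and> x s \<noteq> y s"
    by metis
  define z where "z t = (if last t then x (butlast t) else y (butlast t))" for t :: "bool list"
  have z: "z t \<in> E \<inter> U (butlast t)" if "length t = Suc n" for t
    using xy[of "butlast t"] that by (simp add: z_def)
  have zM: "z t \<in> M" if "length t = Suc n" for t using z[OF that] E(1) A(1) by blast
  have z_inj: "z t \<noteq> z t'" if "length t = Suc n" "length t' = Suc n" "t \<noteq> t'" for t t'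
  proof (cases "butlast t = butlast t'")
    case True
    have "last t \<noteq> last t'"
    proof
      assume "last t = last t'"
      then have "butlast t @ [last t] = butlast t' @ [last t']" by (simp only: True)
      then show False using that by (simp only: snoc_butlast_last)
    qed
    moreover have "x (butlast t) \<noteq> y (butlast t)" using xy that(1) by simp
    ultimately show ?thesis unfolding z_def True[symmetric] by (cases "last t") simp_all
  next
    case False
    then have "U (butlast t) \<inter> U (butlast t') = {}" using disj that(1,2) by simp
    then show ?thesis using z[OF that(1)] z[OF that(2)] by auto
  qed
  have "\<forall>\<^sub>F \<epsilon> in at_right 0. \<epsilon> \<le> (1 / 2 ^ n :: real)"
    unfolding eventually_at_right_field by (intro exI[of _ "1 / 2 ^ n"]) auto
  moreover have "\<forall>\<^sub>F \<epsilon> in at_right 0. \<forall>t \<in> ?I. mcball (z t) \<epsilon> \<subseteq> U (butlast t)"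
  proof (intro eventually_ball_finite ballI finI)
    fix t assume t: "t \<in> ?I"
    then show "\<forall>\<^sub>F \<epsilon> in at_right 0. mcball (z t) \<epsilon> \<subseteq> U (butlast t)"
      using z[of t] by (intro eventually_mcball_subset U) auto
  qed
  moreover have "\<forall>\<^sub>F \<epsilon> in at_right 0. \<forall>t \<in> ?I. \<forall>t' \<in> ?I. t \<noteq> t' \<longrightarrow>
      mcball (z t) \<epsilon> \<inter> mcball (z t') \<epsilon> = {}"
  proof (intro eventually_ball_finite ballI finI)
    fix t t' assume t: "t \<in> ?I" "t' \<in> ?I"
    show "\<forall>\<^sub>F \<epsilon> in at_right 0. t \<noteq> t' \<longrightarrow> mcball (z t) \<epsilon> \<inter> mcball (z t') \<epsilon> = {}"
    proof (cases "t = t'")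
      case False
      then have "\<forall>\<^sub>F \<epsilon> in at_right 0. mcball (z t) \<epsilon> \<inter> mcball (z t') \<epsilon> = {}"
        using t by (intro eventually_disjoint_mcball zM z_inj) auto
      then show ?thesis by eventually_elim simp
    qed simp
  qed
  moreover have "\<forall>\<^sub>F \<epsilon> in at_right 0. \<forall>k \<in> {..n}. \<forall>\<sigma> \<in> {..<N k} \<rightarrow>\<^sub>E ?I. inj_on \<sigma> {..<N k} \<longrightarrow>
      (\<Pi>\<^sub>E i\<in>{..<N k}. mcball (z (\<sigma> i)) \<epsilon>) \<inter> R k = {}"
  proof (intro eventually_ball_finite ballI finite_PiE finI finite_atMost finite_lessThan)
    fix k \<sigma> assume \<sigma>: "\<sigma> \<in> {..<N k} \<rightarrow>\<^sub>E ?I"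
    show "\<forall>\<^sub>F \<epsilon> in at_right 0. inj_on \<sigma> {..<N k} \<longrightarrow>
      (\<Pi>\<^sub>E i\<in>{..<N k}. mcball (z (\<sigma> i)) \<epsilon>) \<inter> R k = {}"
    proof (cases "inj_on \<sigma> {..<N k}")
      case True
      define p where "p = (\<lambda>i\<in>{..<N k}. z (\<sigma> i))"
      have \<sigma>I: "length (\<sigma> i) = Suc n" if "i < N k" for i using \<sigma> that by auto
      have pA: "p \<in> {..<N k} \<rightarrow>\<^sub>E A"
        unfolding p_def restrict_PiE_iff
      proof
        fix i assume "i \<in> {..<N k}"
        then have "z (\<sigma> i) \<in> E" using z \<sigma>I by blast
        then show "z (\<sigma> i) \<in> A" using E(1) by blast
      qed
      have "inj_on p {..<N k}"
      proof (rule inj_onI)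
        fix i j assume ij: "i \<in> {..<N k}" "j \<in> {..<N k}" "p i = p j"
        then have "\<sigma> i = \<sigma> j" using z_inj[of "\<sigma> i" "\<sigma> j"] \<sigma>I by (auto simp: p_def)
        then show "i = j" using True ij by (auto dest: inj_onD)
      qed
      then have "p \<notin> R k" using A(2)[of k] pA unfolding rel_independent_def by blast
      moreover have "p \<in> {..<N k} \<rightarrow>\<^sub>E M" using pA A(1) by (auto simp: PiE_iff)
      ultimately have "\<forall>\<^sub>F \<epsilon> in at_right 0. (\<Pi>\<^sub>E i\<in>{..<N k}. mcball (p i) \<epsilon>) \<inter> R k = {}"
        using eventually_box_avoids_closed[OF R] by blast
      moreover have "(\<Pi>\<^sub>E i\<in>{..<N k}. mcball (p i) \<epsilon>) = (\<Pi>\<^sub>E i\<in>{..<N k}. mcball (z (\<sigma> i)) \<epsilon>)" for \<epsilon>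
        by (intro PiE_cong) (simp add: p_def)
      ultimately show ?thesis by simp
    qed simp
  qed
  moreover have "\<forall>\<^sub>F \<epsilon> in at_right 0. \<epsilon> > (0::real)" by (rule eventually_at_right_less)
  ultimately have "\<forall>\<^sub>F \<epsilon> in at_right (0::real). \<epsilon> > 0 \<and> \<epsilon> \<le> 1 / 2 ^ n \<and>
      (\<forall>t \<in> ?I. mcball (z t) \<epsilon> \<subseteq> U (butlast t)) \<and>
      (\<forall>t \<in> ?I. \<forall>t' \<in> ?I. t \<noteq> t' \<longrightarrow> mcball (z t) \<epsilon> \<inter> mcball (z t') \<epsilon> = {}) \<and>
      (\<forall>k \<in> {..n}. \<forall>\<sigma> \<in> {..<N k} \<rightarrow>\<^sub>E ?I. inj_on \<sigma> {..<N k} \<longrightarrow>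
        (\<Pi>\<^sub>E i\<in>{..<N k}. mcball (z (\<sigma> i)) \<epsilon>) \<inter> R k = {})"
    by (intro eventually_conj)
  then obtain \<epsilon> where \<epsilon>: "\<epsilon> > 0" "\<epsilon> \<le> 1 / 2 ^ n"
      and \<epsilon>U: "\<forall>t \<in> ?I. mcball (z t) \<epsilon> \<subseteq> U (butlast t)"
      and \<epsilon>disj: "\<forall>t \<in> ?I. \<forall>t' \<in> ?I. t \<noteq> t' \<longrightarrow> mcball (z t) \<epsilon> \<inter> mcball (z t') \<epsilon> = {}"
      and \<epsilon>R: "\<forall>k \<in> {..n}. \<forall>\<sigma> \<in> {..<N k} \<rightarrow>\<^sub>E ?I. inj_on \<sigma> {..<N k} \<longrightarrow>
        (\<Pi>\<^sub>E i\<in>{..<N k}. mcball (z (\<sigma> i)) \<epsilon>) \<inter> R k = {}"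
    by (elim exE[OF eventually_happens'[OF trivial_limit_at_right_real]] conjE) (rule that)
  have "\<exists>V \<in> B. z t \<in> V \<and> V \<subseteq> mcball (z t) \<epsilon>" if "length t = Suc n" for t
  proof -
    have "openin mtopology (mball (z t) \<epsilon>)" "z t \<in> mball (z t) \<epsilon>" using zM[OF that] \<epsilon>(1) by auto
    then obtain V where "V \<in> B" "z t \<in> V" "V \<subseteq> mball (z t) \<epsilon>"
      using base_ofE[OF B] by metis
    then show ?thesis using mball_subset_mcball[of "z t" \<epsilon>] by blast
  qed
  then obtain V0 where V0: "\<And>t. length t = Suc n \<Longrightarrow> V0 t \<in> B \<and> z t \<in> V0 t \<and> V0 t \<subseteq> mcball (z t) \<epsilon>"
    by metis
  define V where "V = restrict V0 ?I"
  have V: "V t \<in> B" "z t \<in> V t" "V t \<subseteq> mcball (z t) \<epsilon>" if "length t = Suc n" for t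
    using V0[OF that] that by (simp_all add: V_def)
  have "V \<in> ?I \<rightarrow>\<^sub>E B" using V0 by (auto simp: V_def)
  moreover have "splits N R n U V"
    unfolding splits_def
  proof (intro conjI allI impI ballI)
    fix s :: "bool list" and b assume s: "length s = n"
    then have "mtopology closure_of V (s @ [b]) \<subseteq> mcball (z (s @ [b])) \<epsilon>"
      using V(3)[of "s @ [b]"] by (intro closure_of_minimal closedin_mcball) simp
    then show "mtopology closure_of V (s @ [b]) \<subseteq> U s"
      using bspec[OF \<epsilon>U, of "s @ [b]"] s by auto
    have "V (s @ [b]) \<subseteq> mcball (z (s @ [b])) (1 / 2 ^ n)"
      using V(3)[of "s @ [b]"] s \<epsilon>(2) by force
    then show "\<exists>c. V (s @ [b]) \<subseteq> mcball c (1 / 2 ^ n)" by blast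
  next
    fix s t :: "bool list" assume "length s = Suc n" "length t = Suc n" "s \<noteq> t"
    then show "V s \<inter> V t = {}" using \<epsilon>disj V(3)[of s] V(3)[of t] by blast
  next
    fix k \<sigma> assume k: "k \<le> n" and \<sigma>: "\<sigma> \<in> {..<N k} \<rightarrow>\<^sub>E ?I" "inj_on \<sigma> {..<N k}"
    have "(\<Pi>\<^sub>E i\<in>{..<N k}. V (\<sigma> i)) \<subseteq> (\<Pi>\<^sub>E i\<in>{..<N k}. mcball (z (\<sigma> i)) \<epsilon>)"
      using \<sigma>(1) V(3) by (intro PiE_mono) auto
    then show "(\<Pi>\<^sub>E i\<in>{..<N k}. V (\<sigma> i)) \<inter> R k = {}"
      using bspec[OF bspec[OF \<epsilon>R, of k] \<sigma>(1)] k \<sigma>(2)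
      by (metis Int_mono atMost_iff order_refl subset_empty)
  qed
  moreover have "E \<inter> V s \<noteq> {}" if "length s = Suc n" for s using z[OF that] V(2)[OF that] by blast
  ultimately show ?thesis by blast
qed

section \<open>A perfect independent set from independent sets of unbounded rank\<close>

text \<open>Finitely many distinct points of the scheme belong to distinct branches, which differ on all levels
  from some \<open>n0\<close> on. A level beyond both \<open>n0\<close> and \<open>k\<close> keeps the tuple of points out of \<open>R k\<close>.\<close>

lemma (in Metric_space) scheme_independent:
  fixes g :: "(nat \<Rightarrow> bool) \<Rightarrow> 'a"
  assumes g: "\<And>f n. g f \<in> W n (map f [0..<n])"
    and splits: "\<And>n. splits N R n (W n) (W (Suc n))"
  shows "rel_independent (N k) (R k) (range g)"
  unfolding rel_independent_def
proof (intro ballI impI)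
  fix p assume p: "p \<in> {..<N k} \<rightarrow>\<^sub>E range g" "inj_on p {..<N k}"
  have "\<forall>i. \<exists>f. i < N k \<longrightarrow> p i = g f" using PiE_mem[OF p(1)] by blast
  then obtain f where f: "\<And>i. i < N k \<Longrightarrow> p i = g (f i)" by metis
  have "\<forall>\<^sub>F n in sequentially. \<forall>i \<in> {..<N k}. \<forall>j \<in> {..<N k}. i \<noteq> j \<longrightarrow>
      map (f i) [0..<n] \<noteq> map (f j) [0..<n]"
  proof (intro eventually_ball_finite ballI finite_lessThan)
    fix i j assume ij: "i \<in> {..<N k}" "j \<in> {..<N k}"
    show "\<forall>\<^sub>F n in sequentially. i \<noteq> j \<longrightarrow> map (f i) [0..<n] \<noteq> map (f j) [0..<n]"
    proof (cases "i = j")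
      case False
      then have "p i \<noteq> p j" using inj_onD[OF p(2)] ij by blast
      then have "f i \<noteq> f j" using f ij by auto
      then obtain m where m: "f i m \<noteq> f j m" by blast
      have "map (f i) [0..<n] \<noteq> map (f j) [0..<n]" if "n \<ge> Suc m" for n
        using m that by (auto simp: map_eq_conv)
      then show ?thesis unfolding eventually_sequentially by blast
    qed simp
  qed
  then obtain n0 where n0: "\<forall>n\<ge>n0. \<forall>i \<in> {..<N k}. \<forall>j \<in> {..<N k}. i \<noteq> j \<longrightarrow>
      map (f i) [0..<n] \<noteq> map (f j) [0..<n]"
    unfolding eventually_sequentially by (rule exE)
  define n where "n = max n0 k"
  define \<sigma> where "\<sigma> = (\<lambda>i\<in>{..<N k}. map (f i) [0..<Suc n])"
  have "\<sigma> \<in> {..<N k} \<rightarrow>\<^sub>E {s. length s = Suc n}"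
    unfolding \<sigma>_def restrict_PiE_iff by simp
  moreover have "inj_on \<sigma> {..<N k}"
  proof (rule inj_onI)
    fix i j assume ij: "i \<in> {..<N k}" "j \<in> {..<N k}" "\<sigma> i = \<sigma> j"
    then have "map (f i) [0..<Suc n] = map (f j) [0..<Suc n]"
      by (simp only: \<sigma>_def restrict_apply if_True)
    then show "i = j" using n0[rule_format, of "Suc n" i j] ij(1,2) unfolding n_def by linarith
  qed
  moreover have "k \<le> n" by (simp add: n_def)
  ultimately have "(\<Pi>\<^sub>E i\<in>{..<N k}. W (Suc n) (\<sigma> i)) \<inter> R k = {}"
    using splits[of n] unfolding splits_def by metis
  moreover have "p \<in> (\<Pi>\<^sub>E i\<in>{..<N k}. W (Suc n) (\<sigma> i))"
  proof (rule PiE_I)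
    fix i assume "i \<in> {..<N k}"
    then show "p i \<in> W (Suc n) (\<sigma> i)" using g[of "f i" "Suc n"] f[of i] by (simp add: \<sigma>_def)
  qed (rule PiE_arb[OF p(1)])
  ultimately show "p \<notin> R k" by (metis disjoint_iff)
qed

text \<open>The pigeonhole argument: from a good family of level \<open>n\<close> one always reaches a good family of level
  \<open>n + 1\<close>, because at most \<open>\<kappa>\<close> many candidates compete for the \<open>\<kappa>\<^sup>+\<close> many ordinals.\<close>

lemma (in Metric_space) perfect_independent_if_unbounded_rank:
  fixes \<kappa> :: "'k rel" and N :: "nat \<Rightarrow> nat"
  assumes "mcomplete" and B: "base_of mtopology B"
    and \<kappa>: "Card_order \<kappa>" "\<not> finite (Field \<kappa>)" "|B| \<le>o \<kappa>"
    and R: "\<And>k. closedin (product_topology (\<lambda>_. mtopology) {..<N k}) (R k)"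
    and deep: "\<And>a. a \<in> Field (cardSuc \<kappa>) \<Longrightarrow> \<exists>A \<subseteq> M. (\<forall>k. rel_independent (N k) (R k) A) \<and>
      cb_deriv mtopology A (initial_segment (cardSuc \<kappa>) a) \<noteq> {}"
  shows "\<exists>P. perfect_subset mtopology P \<and> (\<forall>k. rel_independent (N k) (R k) P)"
proof -
  let ?r = "cardSuc \<kappa>"
  have co: "Card_order ?r" using \<kappa>(1) by (rule cardSuc_Card_order)
  then have wo: "Well_order ?r" by (simp add: card_order_on_def)
  have inf: "\<not> finite (Field ?r)" using \<kappa>(1,2) cardSuc_finite by blast
  define D where "D A a = cb_deriv mtopology A (initial_segment ?r a)" for A a
  have D_NI: "D A c \<subseteq> non_isolated mtopology (D A b)" if "b \<in> underS ?r c" for A b c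
    unfolding D_def by (rule cb_deriv_initial_segment_subset[OF wo that])
  have DA: "D A a \<subseteq> A" for A a
    unfolding D_def by (rule cb_deriv_subset[OF Well_order_initial_segment[OF wo]])
  define meets where "meets n U a \<longleftrightarrow> (\<exists>A \<subseteq> M. (\<forall>k. rel_independent (N k) (R k) A) \<and>
    (\<forall>s. length s = n \<longrightarrow> D A a \<inter> U s \<noteq> {}))" for n and U :: "bool list \<Rightarrow> 'a set" and a
  define good where "good n U \<longleftrightarrow> (\<forall>s. length s = n \<longrightarrow> openin mtopology (U s)) \<and>
    (\<forall>s t. length s = n \<longrightarrow> length t = n \<longrightarrow> s \<noteq> t \<longrightarrow> U s \<inter> U t = {}) \<and>
    (\<forall>a \<in> Field ?r. meets n U a)" for n and U :: "bool list \<Rightarrow> 'a set"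
  have "good 0 (\<lambda>_. M)"
    unfolding good_def
  proof (intro conjI ballI)
    fix a assume "a \<in> Field ?r"
    then obtain A where A: "A \<subseteq> M" "\<forall>k. rel_independent (N k) (R k) A" "D A a \<noteq> {}"
      using deep unfolding D_def by metis
    moreover have "D A a \<inter> M = D A a" using DA A(1) by blast
    ultimately show "meets 0 (\<lambda>_. M) a" unfolding meets_def by auto
  qed (auto simp: openin_topspace[of mtopology, simplified])
  moreover have "\<exists>V. good (Suc n) V \<and> splits N R n U V" if "good n U" for n U
  proof (rule ccontr)
    assume none: "\<nexists>V. good (Suc n) V \<and> splits N R n U V"
    have openU: "\<And>s. length s = n \<Longrightarrow> openin mtopology (U s)"
      and disjU: "\<And>s t. length s = n \<Longrightarrow> length t = n \<Longrightarrow> s \<noteq> t \<Longrightarrow> U s \<inter> U t = {}"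
      and meetsU: "\<And>a. a \<in> Field ?r \<Longrightarrow> meets n U a"
      using that unfolding good_def by auto
    let ?I = "{s::bool list. length s = Suc n}"
    define T where "T = {V \<in> ?I \<rightarrow>\<^sub>E B. splits N R n U V}"
    have finI: "finite ?I" using finite_lists_length_eq[of "UNIV :: bool set" "Suc n"] by simp
    have "|T| \<le>o |?I \<rightarrow>\<^sub>E B|" by (rule card_of_mono1) (simp add: T_def)
    then have T: "|T| \<le>o \<kappa>"
      by (rule ordLeq_transitive[OF _ card_of_PiE_ordLeq_infinite[OF \<kappa> finI]])
    have "\<exists>a \<in> Field ?r. \<not> meets (Suc n) V a" if "V \<in> T" for V
    proof -
      have V: "V \<in> ?I \<rightarrow>\<^sub>E B" "splits N R n U V" using that unfolding T_def by auto
      have "openin mtopology (V s)" if "length s = Suc n" for s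
        using PiE_mem[OF V(1), of s] that base_of_openin[OF B] by simp
      moreover have "V s \<inter> V t = {}" if "length s = Suc n" "length t = Suc n" "s \<noteq> t" for s t
        using V(2) that unfolding splits_def by metis
      ultimately show ?thesis using none V(2) unfolding good_def by metis
    qed
    then obtain f where f: "\<And>V. V \<in> T \<Longrightarrow> f V \<in> Field ?r" "\<And>V. V \<in> T \<Longrightarrow> \<not> meets (Suc n) V (f V)"
      by metis
    obtain c where c: "c \<in> Field ?r" "\<And>V. V \<in> T \<Longrightarrow> f V \<in> underS ?r c"
      using bounded_in_cardSuc[of \<kappa> T f, OF \<kappa>(1,2) T f(1)] by blast
    \<comment> \<open>Beyond the bound, points of the \<open>c'\<close>-th derivative are limits of points of the \<open>c\<close>-th one.\<close>
    obtain c' where c': "c' \<in> Field ?r" "c \<in> underS ?r c'"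
      using infinite_Card_order_limit[OF co inf c(1)] unfolding underS_def by auto
    obtain A where A: "A \<subseteq> M" "\<And>k. rel_independent (N k) (R k) A"
        and meetsA: "\<And>s. length s = n \<Longrightarrow> D A c' \<inter> U s \<noteq> {}"
      using meetsU[OF c'(1)] unfolding meets_def by metis
    have "non_isolated mtopology (D A c) \<inter> U s \<noteq> {}" if "length s = n" for s
      using meetsA[OF that] D_NI[OF c'(2), of A] by blast
    then obtain V where V: "V \<in> ?I \<rightarrow>\<^sub>E B" "splits N R n U V"
        "\<And>s. length s = Suc n \<Longrightarrow> D A c \<inter> V s \<noteq> {}"
      using split_at_non_isolated_points[of B n U N R A "D A c", OF B openU disjU R A DA] by blast
    then have VT: "V \<in> T" by (simp add: T_def)
    have "D A c \<subseteq> D A (f V)"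
      using D_NI[OF c(2)[OF VT], of A] non_isolatedD by (metis subset_iff)
    then have "meets (Suc n) V (f V)"
      unfolding meets_def using A V(3) by (intro exI[of _ A]) blast
    then show False using f(2)[OF VT] by simp
  qed
  ultimately obtain W where W: "\<And>n. good n (W n)" "\<And>n. splits N R n (W n) (W (Suc n))"
    using dependent_nat_choice[of good "\<lambda>n U V. splits N R n U V"] by metis
  define u where "u s = W (length s) s" for s
  obtain a where a: "a \<in> Field ?r" using inf by (metis all_not_in_conv finite.emptyI)
  have "u s \<noteq> {}" for s
    using W(1)[of "length s"] a unfolding good_def meets_def u_def by fastforce
  moreover have "u s \<subseteq> M" for s
    using W(1)[of "length s"] openin_subset[of mtopology "u s"] unfolding good_def u_def by simp
  moreover have "mtopology closure_of u (s @ [b]) \<subseteq> u s" for s b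
    using W(2)[of "length s"] unfolding splits_def u_def by simp
  moreover have "\<exists>c. u (s @ [b]) \<subseteq> mcball c (1 / 2 ^ length s)" for s b
    using W(2)[of "length s"] unfolding splits_def u_def by simp
  moreover have "u s \<inter> u t = {}" if "length s = length t" "s \<noteq> t" for s t
    using W(1)[of "length s"] that unfolding good_def u_def by simp
  ultimately obtain g where g: "\<And>f n. g f \<in> u (map f [0..<n])" "perfect_subset mtopology (range g)"
    using Cantor_scheme_perfect[OF \<open>mcomplete\<close>, of u] by metis
  have "g f \<in> W n (map f [0..<n])" for f n using g(1)[of f n] by (simp add: u_def)
  then have "rel_independent (N k) (R k) (range g)" for k
    using W(2) by (rule scheme_independent)
  then show ?thesis using g(2) by blast
qed

section \<open>The dichotomy\<close>

lemma closed_relations_of_fsigma_family: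
  fixes \<R> :: "(nat \<times> (nat \<Rightarrow> 'a) set) set"
  assumes "countable \<R>"
    and fsigma: "\<And>n R. (n, R) \<in> \<R> \<Longrightarrow> fsigma_in (product_topology (\<lambda>_. X) {..<n}) R"
  obtains N :: "nat \<Rightarrow> nat" and C where
    "\<And>k. closedin (product_topology (\<lambda>_. X) {..<N k}) (C k)"
    "\<And>A. (\<forall>(n, R) \<in> \<R>. rel_independent n R A) \<longleftrightarrow> (\<forall>k. rel_independent (N k) (C k) A)"
proof -
  have "\<exists>F. countable F \<and> (\<forall>K \<in> F. closedin (product_topology (\<lambda>_. X) {..<fst q}) K) \<and>
      \<Union>F = snd q" if "q \<in> \<R>" for q
    using fsigma[of "fst q" "snd q"] that unfolding fsigma_in_def union_of_def by auto
  then obtain F where F: "\<And>q. q \<in> \<R> \<Longrightarrow> countable (F q)"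
      "\<And>q K. q \<in> \<R> \<Longrightarrow> K \<in> F q \<Longrightarrow> closedin (product_topology (\<lambda>_. X) {..<fst q}) K"
      "\<And>q. q \<in> \<R> \<Longrightarrow> \<Union>(F q) = snd q"
    by metis
  \<comment> \<open>The empty relation is added so that the family is nonempty and can be enumerated.\<close>
  define Q where "Q = insert (0, {}) (\<Union>q \<in> \<R>. Pair (fst q) ` F q)"
  have "countable Q" unfolding Q_def using \<open>countable \<R>\<close> F(1) by auto
  moreover have "Q \<noteq> {}" by (simp add: Q_def)
  ultimately obtain e :: "nat \<Rightarrow> _" where e: "range e = Q"
    using range_from_nat_into by metis
  have "closedin (product_topology (\<lambda>_. X) {..<fst (e k)}) (snd (e k))" for k
  proof -
    have "e k \<in> Q" using e by blast
    then show ?thesis using F(2) unfolding Q_def by auto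
  qed
  moreover have "(\<forall>(n, R) \<in> \<R>. rel_independent n R A) \<longleftrightarrow>
      (\<forall>k. rel_independent (fst (e k)) (snd (e k)) A)" for A
  proof -
    have "(\<forall>k. rel_independent (fst (e k)) (snd (e k)) A) \<longleftrightarrow>
        (\<forall>q \<in> Q. rel_independent (fst q) (snd q) A)"
      unfolding e[symmetric] by simp
    also have "\<dots> \<longleftrightarrow> (\<forall>q \<in> \<R>. \<forall>K \<in> F q. rel_independent (fst q) K A)"
      by (auto simp: Q_def rel_independent_def)
    also have "\<dots> \<longleftrightarrow> (\<forall>q \<in> \<R>. rel_independent (fst q) (snd q) A)"
    proof (intro ball_cong refl)
      fix q assume "q \<in> \<R>"
      show "(\<forall>K \<in> F q. rel_independent (fst q) K A) \<longleftrightarrow> rel_independent (fst q) (snd q) A"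
        unfolding F(3)[OF \<open>q \<in> \<R>\<close>, symmetric] rel_independent_def by blast
    qed
    finally show ?thesis by (simp add: case_prod_beta)
  qed
  ultimately show ?thesis by (rule that)
qed

theorem theorem1p1:
  fixes X :: "'a topology" and \<kappa> :: "'k rel" and \<R> :: "(nat \<times> (nat \<Rightarrow> 'a) set) set"
  assumes "completely_metrizable_space X"
    and "has_weight X \<kappa>"
    and "natLeq \<le>o \<kappa>"
    and "countable \<R>"
    and "\<And>n R. (n, R) \<in> \<R> \<Longrightarrow> n \<ge> 1 \<and> fsigma_in (product_topology (\<lambda>_. X) {..<n}) R"
  shows "(\<exists>\<gamma> :: 'k set rel. \<gamma> <o cardSuc \<kappa> \<and>
           (\<forall>A. independent_set X \<R> A \<longrightarrow> cb_rank_less X A \<gamma> \<and> cb_deriv X A \<gamma> = {}))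
         \<longleftrightarrow> \<not> (\<exists>P. perfect_subset X P \<and> independent_set X \<R> P)"
    (is "?S \<longleftrightarrow> \<not> ?P")
proof
  assume ?S
  then obtain \<gamma> :: "'k set rel" where \<gamma>: "\<gamma> <o cardSuc \<kappa>"
      "\<And>A. independent_set X \<R> A \<Longrightarrow> cb_deriv X A \<gamma> = {}" by blast
  have "Well_order \<gamma>" using \<gamma>(1) unfolding ordLess_def by blast
  then show "\<not> ?P"
    using \<gamma>(2) cb_deriv_dense_in_itself unfolding perfect_subset_def by metis
next
  assume no_P: "\<not> ?P"
  have \<kappa>: "Card_order \<kappa>" using assms(2) by (simp add: has_weight_def)
  have "natLeq \<le>o |Field \<kappa>|"
    by (rule ordLeq_ordIso_trans[OF assms(3) ordIso_symmetric[OF card_of_Field_ordIso[OF \<kappa>]]])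
  then have inf: "\<not> finite (Field \<kappa>)" using infinite_iff_natLeq_ordLeq[of "Field \<kappa>"] by blast
  obtain B where B: "base_of X B" "|B| =o \<kappa>" using assms(2) by (auto simp: has_weight_def)
  obtain M d where "Metric_space M d" and complete: "Metric_space.mcomplete M d"
      and X: "X = Metric_space.mtopology M d"
    using assms(1) unfolding completely_metrizable_space_def by blast
  interpret Metric_space M d by fact
  obtain N :: "nat \<Rightarrow> nat" and C where
    C: "\<And>k. closedin (product_topology (\<lambda>_. X) {..<N k}) (C k)"
    and indep: "\<And>A. (\<forall>(n, R) \<in> \<R>. rel_independent n R A) \<longleftrightarrow> (\<forall>k. rel_independent (N k) (C k) A)"
    using closed_relations_of_fsigma_family[of \<R> X] assms(4,5) by metis
  let ?r = "cardSuc \<kappa>"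
  have co: "Card_order ?r" using \<kappa> by (rule cardSuc_Card_order)
  then have wo: "Well_order ?r" by (simp add: card_order_on_def)
  have inf': "\<not> finite (Field ?r)" using \<kappa> inf cardSuc_finite by blast
  show ?S
  proof (rule ccontr)
    assume no_S: "\<not> ?S"
    have "\<exists>A \<subseteq> M. (\<forall>k. rel_independent (N k) (C k) A) \<and>
        cb_deriv mtopology A (initial_segment ?r a) \<noteq> {}" if a: "a \<in> Field ?r" for a
    proof -
      \<comment> \<open>An empty derivative at \<open>a\<close> bounds the rank strictly only by ordinals above \<open>a\<close>, hence \<open>b\<close>.\<close>
      obtain b where b: "b \<in> Field ?r" "a \<in> underS ?r b"
        using infinite_Card_order_limit[OF co inf' a] unfolding underS_def by auto
      have "initial_segment ?r b <o ?r" by (rule initial_segment_ordLess[OF wo b(1)])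
      then obtain A where A: "independent_set X \<R> A"
          "\<not> (cb_rank_less X A (initial_segment ?r b) \<and> cb_deriv X A (initial_segment ?r b) = {})"
        using no_S by blast
      have "cb_deriv X A (initial_segment ?r a) \<noteq> {}"
      proof
        assume empty: "cb_deriv X A (initial_segment ?r a) = {}"
        then have "cb_deriv X A (initial_segment ?r b) = {}"
          using cb_deriv_initial_segment_subset[OF wo b(2), of X A] by (auto dest: non_isolatedD)
        then show False using A(2) cb_rank_less_initial_segment[OF wo b(2) empty] by blast
      qed
      moreover have "A \<subseteq> M" "\<forall>k. rel_independent (N k) (C k) A"
        using A(1) indep[of A] unfolding independent_set_def X by auto
      ultimately show ?thesis unfolding X by blast
    qed
    then have "\<exists>P. perfect_subset mtopology P \<and> (\<forall>k. rel_independent (N k) (C k) P)"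
      by (rule perfect_independent_if_unbounded_rank[OF complete B(1)[unfolded X] \<kappa> inf
          ordIso_imp_ordLeq[OF B(2)] C[unfolded X]])
    then obtain P where P: "perfect_subset X P" "\<forall>k. rel_independent (N k) (C k) P"
      unfolding X by blast
    then have "independent_set X \<R> P"
      using indep[of P] unfolding independent_set_def perfect_subset_def by blast
    then show False using no_P P(1) by blast
  qed
qed

end
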